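(* Let $H\ge 2$ be real, let $T\ge 1$ be an integer, and let $\vartheta$ be a real number with $$\frac{H^T-\frac1H}{H^T+1}<\vartheta\le\frac{H^T}{H^T+1}.$$ Let $f$ be the generalized tent map with parameter $H$ and let $F(x)=f\left(\vartheta x+(1-\vartheta)f^{(T)}(x)\right)$. Then the set $\left[0,\frac H2\right]$ is an invariant set of the equation $x_{n+1}=F(x_n)$. Moreover, any $T$-cycle $\{\eta_1,\ldots,\eta_T\}$ of $f$ for which the quantity $\mu=f'(\eta_T)\cdots f'(\eta_1)$ is negative is a locally asymptotically stable cycle of $x_{n+1}=F(x_n)$.
   Context: The generalized tent map with parameter $H\ge2$ is $f:\mathbb{R}\to\mathbb{R}$, $f(x)=H\left(\frac12-\left|x-\frac12\right|\right)$, i.e. $f(x)=Hx$ for $x\le\frac12$ and $f(x)=H(1-x)$ for $x>\frac12$. For a map $g$, $g^{(k)}$ denotes the $k$-fold iterate of $g$. A set $U$ is invariant for $x_{n+1}=g(x_n)$ if for every $x_0\in U$ one has $g^{(k)}(x_0)\in U$ for $k=1,2,\ldots$. A $T$-cycle of $g$ is a set of $T$ distinct points $\{\eta_1,\ldots,\eta_T\}$ with $\eta_{j+1}=g(\eta_j)$ for $j=1,\ldots,T-1$ and $\eta_1=g(\eta_T)$. Every $T$-cycle of $f$ is also a $T$-cycle of $F$. Local asymptotic stability of a cycle is understood in the usual sense (Lyapunov stable, and attracting all orbits starting sufficiently near it). *)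

theory Defs
  imports "HOL-Analysis.Analysis"
begin

definition tent :: "real \<Rightarrow> real \<Rightarrow> real" where
  "tent H x = H * (1/2 - \<bar>x - 1/2\<bar>)"

definition controlled_tent :: "real \<Rightarrow> nat \<Rightarrow> real \<Rightarrow> real \<Rightarrow> real" where
  "controlled_tent H T \<theta> x = tent H (\<theta> * x + (1 - \<theta>) * (tent H ^^ T) x)"

definition invariant_set :: "'a set \<Rightarrow> ('a \<Rightarrow> 'a) \<Rightarrow> bool" where
  "invariant_set U g \<longleftrightarrow> (\<forall>x0\<in>U. \<forall>k\<ge>1. (g ^^ k) x0 \<in> U)"

(* Only the values of \<eta> on {1..T} matter; they list the cycle in orbit order. *)
definition is_cycle :: "('a \<Rightarrow> 'a) \<Rightarrow> nat \<Rightarrow> (nat \<Rightarrow> 'a) \<Rightarrow> bool" where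
  "is_cycle g T \<eta> \<longleftrightarrow>
     T \<ge> 1 \<and> inj_on \<eta> {1..T} \<and>
     (\<forall>j\<in>{1..<T}. \<eta> (j + 1) = g (\<eta> j)) \<and> \<eta> 1 = g (\<eta> T)"

definition lyapunov_stable_set :: "('a::metric_space \<Rightarrow> 'a) \<Rightarrow> 'a set \<Rightarrow> bool" where
  "lyapunov_stable_set g C \<longleftrightarrow>
     (\<forall>\<epsilon>>0. \<exists>\<delta>>0. \<forall>x0. infdist x0 C < \<delta> \<longrightarrow> (\<forall>n. infdist ((g ^^ n) x0) C < \<epsilon>))"

definition locally_attracting_set :: "('a::metric_space \<Rightarrow> 'a) \<Rightarrow> 'a set \<Rightarrow> bool" where
  "locally_attracting_set g C \<longleftrightarrow>
     (\<exists>\<delta>>0. \<forall>x0. infdist x0 C < \<delta> \<longrightarrow> (\<lambda>n. infdist ((g ^^ n) x0) C) \<longlonglongrightarrow> 0)"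

definition locally_asymptotically_stable_cycle ::
    "('a::metric_space \<Rightarrow> 'a) \<Rightarrow> nat \<Rightarrow> (nat \<Rightarrow> 'a) \<Rightarrow> bool" where
  "locally_asymptotically_stable_cycle g T \<eta> \<longleftrightarrow>
     is_cycle g T \<eta> \<and>
     lyapunov_stable_set g (\<eta> ` {1..T}) \<and> locally_attracting_set g (\<eta> ` {1..T})"

(* For H \<ge> 2 no cycle of tent H contains 1/2, the only point where tent H is not
   differentiable, so every factor below is a genuine derivative. *)
definition cycle_multiplier :: "(real \<Rightarrow> real) \<Rightarrow> nat \<Rightarrow> (nat \<Rightarrow> real) \<Rightarrow> real" where
  "cycle_multiplier g T \<eta> = (\<Prod>j=1..T. deriv g (\<eta> j))"

end

theory Submission imports Defs begin

text \<open>
  Write \<open>f = tent H\<close> and \<open>F = controlled_tent H T \<theta>\<close>, so that \<open>F x = f y\<close> with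
  \<open>y = \<theta> x + (1 - \<theta>) f\<^sup>T(x)\<close>, a convex combination of a point and its \<open>T\<close>-th image.

  Invariance. Since \<open>f\<close> maps \<open>[0, 1]\<close> into \<open>[0, H/2]\<close>, it is enough that \<open>y\<close> lies in
  \<open>[0, 1]\<close> whenever \<open>x\<close> lies in \<open>[0, H/2]\<close>. The lower bound on \<open>\<theta>\<close> says exactly that
  \<open>\<theta> / (1 - \<theta>) > c\<close> with \<open>c = (H\<^sup>T\<^sup>+\<^sup>1 - 1) / (H + 1)\<close>. Thus \<open>0 \<le> y\<close> follows from
  \<open>f\<^sup>T(x) \<ge> - c x\<close> and, for \<open>x \<le> 1\<close>, \<open>y \<le> 1\<close> follows from \<open>f\<^sup>T(x) - 1 \<le> c (1 - x)\<close>: the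
  graph of \<open>f\<^sup>T\<close> stays above a line of slope \<open>- c\<close> through the origin and below the
  parallel line through \<open>(1, 1)\<close> (lemmas \<open>tent_iterate_lower_line\<close> and
  \<open>tent_iterate_upper_line\<close>). For \<open>x > 1\<close> the bound \<open>y \<le> 1\<close> comes instead from
  \<open>f\<^sup>T(x) \<le> H\<^sup>T (1 - x)\<close> and the upper bound on \<open>\<theta>\<close>.

  Stability. The turning point \<open>1/2\<close> is not periodic, because its second image is \<open>\<le> 0\<close> and
  the half-line of nonpositive numbers cannot be left. So near each point of a cycle \<open>f\<^sup>T\<close> is
  affine, with slope the product of the slopes \<open>\<plusminus>H\<close> along the cycle, and this product is
  \<open>- H\<^sup>T\<close> if it is negative. Hence near a cycle point \<open>F\<close> is affine with slope
  \<open>\<plusminus>H (\<theta> - (1 - \<theta>) H\<^sup>T)\<close>. The two bounds on \<open>\<theta>\<close> place \<open>\<theta> - (1 - \<theta>) H\<^sup>T\<close> in \<open>(- 1/H, 0]\<close>, so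
  \<open>F\<close> contracts towards the cycle at each of its points
  (\<open>controlled_tent_lipschitz_near_periodic_point\<close>), and a finite set
  towards which a map contracts is asymptotically stable (\<open>local_contraction_stable\<close>).
\<close>

section \<open>Invariance of the interval\<close>

lemma tent_le_half: "H \<ge> 0 \<Longrightarrow> tent H x \<le> H / 2"
  unfolding tent_def using mult_left_mono[of "1/2 - \<bar>x - 1/2\<bar>" "1/2" H] by simp

lemma tent_le_left_branch: "H \<ge> 0 \<Longrightarrow> tent H x \<le> H * x"
  unfolding tent_def by (intro mult_left_mono) auto

lemma tent_le_right_branch: "H \<ge> 0 \<Longrightarrow> tent H x \<le> H * (1 - x)"
  unfolding tent_def by (intro mult_left_mono) auto

lemma tent_nonneg: "H \<ge> 0 \<Longrightarrow> 0 \<le> x \<Longrightarrow> x \<le> 1 \<Longrightarrow> 0 \<le> tent H x"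
  unfolding tent_def by (intro mult_nonneg_nonneg) (auto simp: abs_if)

lemma tent_of_le_half: "x \<le> 1/2 \<Longrightarrow> tent H x = H * x"
  unfolding tent_def by simp

lemma tent_of_ge_half: "x \<ge> 1/2 \<Longrightarrow> tent H x = H * (1 - x)"
  unfolding tent_def by simp

lemma tent_iterate_of_nonpos:
  assumes "H \<ge> 0" "x \<le> 0"
  shows "(tent H ^^ k) x = H ^ k * x"
proof (induction k)
  case (Suc k)
  have "H ^ k * x \<le> 0" using assms by (simp add: mult_nonneg_nonpos)
  then show ?case using Suc by (simp add: tent_of_le_half)
qed simp

lemma tent_iterate_le_linear:
  assumes "H \<ge> 0"
  shows "(tent H ^^ k) x \<le> H ^ k * x"
proof (induction k)
  case (Suc k)
  have "(tent H ^^ Suc k) x \<le> H * (tent H ^^ k) x"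
    using tent_le_left_branch[OF assms] by simp
  also have "\<dots> \<le> H * (H ^ k * x)" using Suc assms by (rule mult_left_mono)
  finally show ?case by simp
qed simp

lemma tent_iterate_le_reflected:
  assumes "H \<ge> 0" "T \<ge> 1"
  shows "(tent H ^^ T) x \<le> H ^ T * (1 - x)"
proof -
  obtain k where T: "T = Suc k" using assms by (cases T) auto
  have "(tent H ^^ T) x = (tent H ^^ k) (tent H x)" by (simp add: T funpow_swap1)
  also have "\<dots> \<le> H ^ k * tent H x" by (rule tent_iterate_le_linear[OF assms(1)])
  also have "\<dots> \<le> H ^ k * (H * (1 - x))"
    using assms tent_le_right_branch by (intro mult_left_mono) auto
  finally show ?thesis by (simp add: T mult.assoc mult.left_commute)
qed

text \<open>Pulling back along the first step works because \<open>f x \<le> H x\<close> and \<open>H c\<^sub>T \<le> c\<^sub>T\<^sub>+\<^sub>1\<close> for the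
  slopes \<open>c\<^sub>T = (H\<^sup>T\<^sup>+\<^sup>1 - 1) / (H + 1)\<close>. Only points \<open>x > 1\<close> leave \<open>[0, H/2]\<close> in one step, and
  from then on the iterates are exactly linear.\<close>
lemma tent_iterate_lower_line:
  assumes "H \<ge> 2" "0 \<le> x" "x \<le> H / 2"
  shows "0 \<le> (H + 1) * (tent H ^^ T) x + (H ^ (T + 1) - 1) * x"
  using assms(2,3)
proof (induction T arbitrary: x)
  case 0
  have "H * x \<ge> 0" using assms 0 by simp
  then show ?case by (simp add: algebra_simps)
next
  case (Suc T)
  define p where "p = H ^ (T + 1)"
  have p1: "p \<ge> 1" unfolding p_def using assms by (intro one_le_power) auto
  have step: "(tent H ^^ Suc T) x = (tent H ^^ T) (tent H x)" by (simp add: funpow_swap1)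
  show ?case
  proof (cases "x \<le> 1")
    case True
    define z where "z = tent H x"
    have z: "0 \<le> z" "z \<le> H / 2" "z \<le> H * x"
      unfolding z_def
      using assms True Suc.prems tent_nonneg[of H x] tent_le_half[of H x] tent_le_left_branch[of H x]
      by simp_all
    have "(p - 1) * z \<le> (p - 1) * (H * x)" using p1 z by (intro mult_left_mono) auto
    also have "\<dots> \<le> (H * p - 1) * x"
      using mult_right_mono[of 1 H x] assms Suc.prems by (simp add: algebra_simps)
    finally have "(p - 1) * z \<le> (H * p - 1) * x" .
    moreover have "0 \<le> (H + 1) * (tent H ^^ T) z + (p - 1) * z"
      unfolding p_def using Suc.IH z by blast
    ultimately show ?thesis unfolding step z_def[symmetric] by (simp add: p_def)
  next
    case False
    have z: "tent H x = H * (1 - x)" using False by (intro tent_of_ge_half) auto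
    have "H * (1 - x) \<le> 0" using False assms by (simp add: mult_nonneg_nonpos)
    then have v: "(tent H ^^ Suc T) x = p * (1 - x)"
      unfolding step z using tent_iterate_of_nonpos[of H "H * (1 - x)" T] assms
      by (simp add: p_def mult.assoc mult.left_commute)
    have "(p + 1) * x \<le> (p + 1) * (H / 2)" using p1 Suc.prems by (intro mult_left_mono) auto
    also have "\<dots> \<le> p * H" using mult_right_mono[of 1 p H] p1 assms by (simp add: field_simps)
    finally have "(p + 1) * x \<le> p * H" .
    then show ?thesis unfolding v using p1 by (simp add: p_def algebra_simps)
  qed
qed

text \<open>Two crude bounds combine: close to \<open>1\<close> the steep right-hand bound \<open>H\<^sup>T (1 - x)\<close> is below
  the line, and further away the global maximum \<open>H/2\<close> of \<open>f\<close> is. The two ranges overlap.\<close>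
lemma tent_iterate_upper_line:
  assumes "H \<ge> 2" "T \<ge> 1" "x \<le> 1"
  shows "(H + 1) * ((tent H ^^ T) x - 1) \<le> (H ^ (T + 1) - 1) * (1 - x)"
proof -
  define p u where "p = H ^ T" and "u = 1 - x"
  define v where "v = (tent H ^^ T) x"
  have p1: "p \<ge> 1" unfolding p_def using assms by (intro one_le_power) auto
  have pH: "H \<le> H * p" using mult_left_mono[of 1 p H] p1 assms by simp
  have u0: "u \<ge> 0" using assms by (simp add: u_def)
  have v1: "v \<le> p * u"
    unfolding v_def p_def u_def using assms by (intro tent_iterate_le_reflected) auto
  obtain k where "T = Suc k" using assms by (cases T) auto
  then have v2: "v \<le> H / 2" unfolding v_def using tent_le_half[of H "(tent H ^^ k) x"] assms by simp
  have "(H + 1) * (v - 1) \<le> (H * p - 1) * u"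
  proof (cases "(p + 1) * u \<le> H + 1")
    case True
    have "(H + 1) * (v - 1) \<le> (H + 1) * (p * u - 1)"
      using v1 assms by (intro mult_left_mono) auto
    then show ?thesis using True by (simp add: algebra_simps)
  next
    case False
    have *: "(H / 2 - 1) * (p + 1) \<le> H * p - 1"
    proof -
      have "(H / 2 - 1) * (p + 1) = H * p / 2 + H / 2 - p - 1" by (simp add: field_simps)
      then show ?thesis using pH p1 by linarith
    qed
    have "(H / 2 - 1) * (H + 1) \<le> (H / 2 - 1) * ((p + 1) * u)"
      using False assms by (intro mult_left_mono) auto
    also have "\<dots> \<le> (H * p - 1) * u" using mult_right_mono[OF * u0] by (simp add: mult.assoc)
    finally have "(H / 2 - 1) * (H + 1) \<le> (H * p - 1) * u" .
    moreover have "(H + 1) * (v - 1) \<le> (H + 1) * (H / 2 - 1)"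
      using v2 assms by (intro mult_left_mono) auto
    ultimately show ?thesis by (simp add: mult.commute)
  qed
  then show ?thesis by (simp add: p_def u_def v_def)
qed

lemma invariant_setI:
  assumes "\<And>x. x \<in> U \<Longrightarrow> g x \<in> U"
  shows "invariant_set U g"
proof -
  have "(g ^^ k) x \<in> U" if "x \<in> U" for x k
    using that by (induction k) (auto intro: assms)
  then show ?thesis by (auto simp: invariant_set_def)
qed

lemma controlled_tent_invariant:
  assumes H: "H \<ge> 2" and T: "T \<ge> 1"
    and lo: "(H ^ T - 1 / H) / (H ^ T + 1) < \<theta>"
    and hi: "\<theta> \<le> H ^ T / (H ^ T + 1)"
  shows "invariant_set {0..H / 2} (controlled_tent H T \<theta>)"
proof (rule invariant_setI)
  fix x assume x: "x \<in> {0..H / 2}"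
  define p where "p = H ^ T"
  define v where "v = (tent H ^^ T) x"
  define y where "y = \<theta> * x + (1 - \<theta>) * v"
  have p1: "p \<ge> 1" unfolding p_def using H by (intro one_le_power) auto
  have Hp: "H * p \<ge> 2" using mult_mono[of 2 H 1 p] H p1 by simp
  have lo': "H * p - 1 < \<theta> * (H * (p + 1))"
  proof -
    have "p - 1 / H < \<theta> * (p + 1)"
      using lo p1 by (simp add: p_def[symmetric] pos_divide_less_eq)
    then have "H * (p - 1 / H) < H * (\<theta> * (p + 1))"
      using H by (intro mult_strict_left_mono) auto
    then show ?thesis using H by (simp add: algebra_simps)
  qed
  have hi': "\<theta> \<le> (1 - \<theta>) * p"
    using hi p1 by (simp add: p_def[symmetric] field_simps)
  have th1: "\<theta> < 1"
  proof -
    have "p / (p + 1) < 1" using p1 by simp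
    then show ?thesis using hi by (simp add: p_def[symmetric])
  qed
  \<comment> \<open>This is \<open>c \<le> \<theta> / (1 - \<theta>)\<close> without the fractions.\<close>
  have slope: "(1 - \<theta>) * (H * p - 1) \<le> \<theta> * (H + 1)"
    using lo' by (simp add: algebra_simps)
  have y0: "0 \<le> y"
  proof -
    have "0 \<le> (1 - \<theta>) * ((H + 1) * v + (H * p - 1) * x)"
      using tent_iterate_lower_line[of H x T] H x th1
      by (intro mult_nonneg_nonneg) (auto simp: p_def v_def)
    also have "\<dots> = (H + 1) * ((1 - \<theta>) * v) + ((1 - \<theta>) * (H * p - 1)) * x"
      by (simp add: algebra_simps)
    also have "\<dots> \<le> (H + 1) * ((1 - \<theta>) * v) + (\<theta> * (H + 1)) * x"
      using mult_right_mono[OF slope, of x] x by simp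
    also have "\<dots> = (H + 1) * y" by (simp add: y_def algebra_simps)
    finally show ?thesis using H by (simp add: zero_le_mult_iff)
  qed
  have y1: "y \<le> 1"
  proof (cases "x \<le> 1")
    case True
    have "(H + 1) * (v - 1) \<le> (H * p - 1) * (1 - x)"
      using tent_iterate_upper_line[OF H T True] by (simp add: p_def v_def)
    then have "(1 - \<theta>) * ((H + 1) * (v - 1)) \<le> (1 - \<theta>) * ((H * p - 1) * (1 - x))"
      using th1 by (intro mult_left_mono) auto
    also have "\<dots> \<le> (\<theta> * (H + 1)) * (1 - x)"
      using mult_right_mono[OF slope, of "1 - x"] True by (simp add: mult.assoc)
    finally have "(H + 1) * (y - 1) \<le> 0" by (simp add: y_def algebra_simps)
    then show ?thesis using H by (simp add: mult_le_0_iff)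
  next
    case False
    have "v \<le> p * (1 - x)"
      unfolding v_def p_def using H T by (intro tent_iterate_le_reflected) auto
    then have "(1 - \<theta>) * v \<le> (1 - \<theta>) * (p * (1 - x))"
      using th1 by (intro mult_left_mono) auto
    also have "\<dots> \<le> \<theta> * (1 - x)"
      using mult_right_mono_neg[OF hi', of "1 - x"] False by (simp add: mult.assoc)
    finally show ?thesis using th1 by (simp add: y_def algebra_simps)
  qed
  have "controlled_tent H T \<theta> x = tent H y"
    by (simp add: controlled_tent_def y_def v_def)
  then show "controlled_tent H T \<theta> x \<in> {0..H / 2}"
    using tent_nonneg[of H y] tent_le_half[of H y] H y0 y1 by simp
qed

section \<open>Stability of finite sets under local contraction\<close>

text \<open>The radius on which a point of \<open>C\<close> attracts may be taken uniform because \<open>C\<close> is finite. A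
  starting point close to \<open>C\<close> is close to some \<open>a \<in> C\<close>, and its orbit then shadows the orbit of
  \<open>a\<close> inside \<open>C\<close> at geometrically decreasing distance.\<close>
lemma local_contraction_stable:
  fixes g :: "'a::metric_space \<Rightarrow> 'a"
  assumes fin: "finite C" and ne: "C \<noteq> {}"
    and maps: "\<And>a. a \<in> C \<Longrightarrow> g a \<in> C"
    and q: "0 \<le> q" "q < 1"
    and contr: "\<And>a. a \<in> C \<Longrightarrow> \<forall>\<^sub>F x in nhds a. dist (g x) (g a) \<le> q * dist x a"
  shows "lyapunov_stable_set g C" "locally_attracting_set g C"
proof -
  have "\<forall>a\<in>C. \<exists>d>0. \<forall>x. dist x a < d \<longrightarrow> dist (g x) (g a) \<le> q * dist x a"
    using contr by (simp add: eventually_nhds_metric)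
  then obtain r where r: "\<And>a. a \<in> C \<Longrightarrow> r a > 0"
    "\<And>a x. a \<in> C \<Longrightarrow> dist x a < r a \<Longrightarrow> dist (g x) (g a) \<le> q * dist x a"
    by metis
  define d where "d = Min (r ` C)"
  have d0: "d > 0" unfolding d_def using fin ne r(1) by simp
  have dr: "d \<le> r a" if "a \<in> C" for a unfolding d_def using fin that by simp
  have shadow: "(g ^^ n) a \<in> C \<and> dist ((g ^^ n) x) ((g ^^ n) a) \<le> q ^ n * dist x a"
    if a: "a \<in> C" and x: "dist x a < d" for a x n
  proof (induction n)
    case 0
    then show ?case using a by simp
  next
    case (Suc n)
    let ?b = "(g ^^ n) a" and ?y = "(g ^^ n) x"
    have b: "?b \<in> C" and le: "dist ?y ?b \<le> q ^ n * dist x a" using Suc by auto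
    have "q ^ n * dist x a \<le> dist x a"
      using q by (intro mult_left_le_one_le) (auto intro: power_le_one)
    then have "dist ?y ?b < r ?b" using le x dr[OF b] by linarith
    then have "dist (g ?y) (g ?b) \<le> q * dist ?y ?b" using r(2) b by blast
    also have "\<dots> \<le> q * (q ^ n * dist x a)" using le q by (intro mult_left_mono) auto
    finally show ?case using maps[OF b] by (simp add: mult.assoc)
  qed
  have bound: "infdist ((g ^^ n) x) C \<le> q ^ n * infdist x C" if "infdist x C < d" for x n
  proof -
    have "infdist x C = Min (dist x ` C)"
      using fin ne by (simp add: infdist_notempty cInf_eq_Min)
    then obtain a where "a \<in> C" "infdist x C = dist x a"
      using Min_in[of "dist x ` C"] fin ne by (metis finite_imageI image_is_empty imageE)
    then show ?thesis
      using shadow[of a x n] that infdist_le[of "(g ^^ n) a" C "(g ^^ n) x"] by auto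
  qed
  show "lyapunov_stable_set g C"
    unfolding lyapunov_stable_set_def
  proof (intro allI impI)
    fix e :: real assume e: "e > 0"
    have "infdist ((g ^^ n) x) C < e" if x: "infdist x C < min d e" for x n
    proof -
      have "q ^ n * infdist x C \<le> infdist x C"
        using q by (intro mult_left_le_one_le) (auto intro: power_le_one infdist_nonneg)
      then show ?thesis using bound[of x n] x by simp
    qed
    then show "\<exists>\<delta>>0. \<forall>x0. infdist x0 C < \<delta> \<longrightarrow> (\<forall>n. infdist ((g ^^ n) x0) C < e)"
      using e d0 by (intro exI[of _ "min d e"]) auto
  qed
  have "(\<lambda>n. infdist ((g ^^ n) x) C) \<longlonglongrightarrow> 0" if x: "infdist x C < d" for x
  proof (rule tendsto_sandwich[OF _ _ tendsto_const])
    show "(\<lambda>n. q ^ n * infdist x C) \<longlonglongrightarrow> 0"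
      using LIMSEQ_power_zero[of q] q by (intro tendsto_mult_left_zero) auto
  qed (use bound[OF x] in \<open>auto intro!: always_eventually infdist_nonneg\<close>)
  then show "locally_attracting_set g C"
    unfolding locally_attracting_set_def using d0 by blast
qed

section \<open>Cycles and periodic points\<close>

lemma cycle_orbit:
  assumes "is_cycle g T \<eta>" "i < T"
  shows "\<eta> (Suc i) = (g ^^ i) (\<eta> 1)"
  using assms(2)
proof (induction i)
  case (Suc i)
  then show ?case using assms(1) by (simp add: is_cycle_def)
qed simp

lemma periodic_iterate:
  assumes "(g ^^ T) a = a"
  shows "(g ^^ T) ((g ^^ i) a) = (g ^^ i) a"
proof -
  have "(g ^^ T) ((g ^^ i) a) = (g ^^ (T + i)) a" by (simp add: funpow_add)
  also have "\<dots> = (g ^^ i) ((g ^^ T) a)" by (simp add: funpow_add add.commute[of T i])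
  finally show ?thesis by (simp add: assms)
qed

lemma cycle_first_periodic:
  assumes "is_cycle g T \<eta>"
  shows "(g ^^ T) (\<eta> 1) = \<eta> 1"
proof -
  obtain k where T: "T = Suc k" using assms by (cases T) (auto simp: is_cycle_def)
  then have "\<eta> T = (g ^^ k) (\<eta> 1)" using cycle_orbit[OF assms, of k] by simp
  then show ?thesis using assms by (simp add: is_cycle_def T)
qed

lemma cycle_point_orbit:
  assumes "is_cycle g T \<eta>" "a \<in> \<eta> ` {1..T}"
  obtains i where "a = (g ^^ i) (\<eta> 1)"
proof -
  obtain j where j: "1 \<le> j" "j \<le> T" "a = \<eta> j" using assms by auto
  then obtain i where "j = Suc i" by (cases j) auto
  then show ?thesis using that[of i] cycle_orbit[OF assms(1), of i] j by simp
qed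

lemma cycle_point_periodic:
  assumes "is_cycle g T \<eta>" "a \<in> \<eta> ` {1..T}"
  shows "(g ^^ T) a = a"
proof -
  obtain i where i: "a = (g ^^ i) (\<eta> 1)" using cycle_point_orbit[OF assms] .
  show ?thesis unfolding i by (rule periodic_iterate[OF cycle_first_periodic[OF assms(1)]])
qed

lemma cycle_image_closed:
  assumes c: "is_cycle g T \<eta>" and a: "a \<in> \<eta> ` {1..T}"
  shows "g a \<in> \<eta> ` {1..T}"
proof -
  obtain j where j: "1 \<le> j" "j \<le> T" "a = \<eta> j" using a by auto
  show ?thesis
  proof (cases "j = T")
    case True
    then have "g a = \<eta> 1" using c j by (simp add: is_cycle_def)
    then show ?thesis using j by auto
  next
    case False
    then have "g a = \<eta> (j + 1)" using c j by (simp add: is_cycle_def)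
    then show ?thesis using j False by auto
  qed
qed

lemma is_cycle_cong:
  assumes "\<And>a. a \<in> \<eta> ` {1..T} \<Longrightarrow> h a = g a"
  shows "is_cycle h T \<eta> \<longleftrightarrow> is_cycle g T \<eta>"
  using assms by (auto simp: is_cycle_def)

section \<open>Linearisation of the tent map along a cycle\<close>

text \<open>If \<open>1/2\<close> were periodic, so would be its second image. But that image is nonpositive,
  and no orbit returns from there to \<open>1/2\<close>.\<close>
lemma tent_periodic_ne_half:
  assumes H: "H \<ge> 2" and T: "T \<ge> 1" and per: "(tent H ^^ T) a = a"
  shows "a \<noteq> 1/2"
proof
  assume a: "a = 1/2"
  have "tent H a = H / 2" by (simp add: a tent_def)
  moreover have "tent H (H / 2) = H * (1 - H / 2)" using H by (intro tent_of_ge_half) auto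
  ultimately have b: "(tent H ^^ 2) a = H * (1 - H / 2)" by (simp only: numeral_2_eq_2 funpow.simps comp_apply id_apply)
  have b0: "(tent H ^^ 2) a \<le> 0" unfolding b using H by (simp add: mult_nonneg_nonpos)
  \<comment> \<open>Two periods are at least two steps, also when \<open>T = 1\<close>, so the orbit passes through
    the second image before it returns to \<open>a\<close>.\<close>
  have "a = (tent H ^^ (T + T)) a" using per by (simp add: funpow_add)
  also have "\<dots> = (tent H ^^ ((T + T - 2) + 2)) a"
    using T by (intro arg_cong[where f = "\<lambda>n. (tent H ^^ n) a"]) linarith
  also have "\<dots> = (tent H ^^ (T + T - 2)) ((tent H ^^ 2) a)" by (simp only: funpow_add comp_apply)
  also have "\<dots> \<le> 0" using tent_iterate_of_nonpos[OF _ b0] H b0 by (simp add: mult_nonneg_nonpos)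
  finally show False using a by simp
qed

definition tent_slope :: "real \<Rightarrow> real \<Rightarrow> real" where
  "tent_slope H x = (if x < 1/2 then H else - H)"

lemma tent_affine_near:
  assumes "a \<noteq> 1/2"
  shows "\<forall>\<^sub>F x in nhds a. tent H x = tent H a + tent_slope H a * (x - a)"
proof (cases "a < 1/2")
  case True
  then have "\<forall>\<^sub>F x in nhds a. x < 1/2"
    using eventually_nhds_in_open[of "{..<1/2}" a] by simp
  then show ?thesis
    by (rule eventually_mono) (use True in \<open>simp add: tent_of_le_half tent_slope_def algebra_simps\<close>)
next
  case False
  with assms have "\<forall>\<^sub>F x in nhds a. 1/2 < x"
    using eventually_nhds_in_open[of "{1/2<..}" a] by simp
  then show ?thesis
    by (rule eventually_mono) (use False in \<open>simp add: tent_of_ge_half tent_slope_def algebra_simps\<close>)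
qed

lemma deriv_tent:
  assumes "a \<noteq> 1/2"
  shows "deriv (tent H) a = tent_slope H a"
proof -
  have "((\<lambda>x. tent H a + tent_slope H a * (x - a)) has_field_derivative tent_slope H a) (at a)"
    by (auto intro!: derivative_eq_intros)
  then have "(tent H has_field_derivative tent_slope H a) (at a)"
    using DERIV_cong_ev[OF refl tent_affine_near[OF assms] refl] by blast
  then show ?thesis by (rule DERIV_imp_deriv)
qed

lemma eventually_nhds_affine:
  fixes a b m :: real
  assumes "\<forall>\<^sub>F x in nhds b. P x"
  shows "\<forall>\<^sub>F x in nhds a. P (b + m * (x - a))"
proof -
  have "((\<lambda>x. b + m * (x - a)) \<longlongrightarrow> b + m * (a - a)) (nhds a)"
    by (intro tendsto_intros filterlim_ident)
  then show ?thesis using assms by (auto simp: filterlim_iff)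
qed

lemma tent_iterate_affine_near:
  assumes "\<And>i. i < k \<Longrightarrow> (tent H ^^ i) a \<noteq> 1/2"
  shows "\<forall>\<^sub>F x in nhds a.
    (tent H ^^ k) x = (tent H ^^ k) a + (\<Prod>i<k. tent_slope H ((tent H ^^ i) a)) * (x - a)"
  using assms
proof (induction k)
  case (Suc k)
  let ?b = "(tent H ^^ k) a" and ?m = "\<Prod>i<k. tent_slope H ((tent H ^^ i) a)"
  have "\<forall>\<^sub>F x in nhds a. (tent H ^^ k) x = ?b + ?m * (x - a)"
    by (rule Suc.IH) (rule Suc.prems, simp)
  moreover have "\<forall>\<^sub>F x in nhds a. tent H (?b + ?m * (x - a)) =
      tent H ?b + tent_slope H ?b * (?b + ?m * (x - a) - ?b)"
    by (intro eventually_nhds_affine[where P = "\<lambda>y. tent H y = tent H ?b + tent_slope H ?b * (y - ?b)"]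
          tent_affine_near Suc.prems) simp
  ultimately show ?case by eventually_elim simp
qed simp

text \<open>Moving the starting point one step along a periodic orbit drops the first factor and
  appends it again at the end. This is why the multiplier belongs to the cycle and not to a
  chosen starting point.\<close>
lemma prod_orbit_shift:
  fixes s :: "'a \<Rightarrow> 'b::comm_monoid_mult"
  assumes "(g ^^ T) a = a"
  shows "(\<Prod>i<T. s ((g ^^ i) (g a))) = (\<Prod>i<T. s ((g ^^ i) a))"
proof (cases T)
  case (Suc k)
  have eq: "(g ^^ i) (g a) = (g ^^ Suc i) a" for i by (simp add: funpow_swap1)
  have "(\<Prod>i<T. s ((g ^^ i) (g a))) = (\<Prod>i<k. s ((g ^^ Suc i) a)) * s ((g ^^ T) a)"
    unfolding eq by (simp only: Suc prod.lessThan_Suc)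
  also have "\<dots> = s ((g ^^ 0) a) * (\<Prod>i<k. s ((g ^^ Suc i) a))"
    by (simp add: assms mult.commute)
  also have "\<dots> = (\<Prod>i<T. s ((g ^^ i) a))"
    by (simp only: Suc prod.lessThan_Suc_shift)
  finally show ?thesis .
qed simp

lemma prod_orbit_iterate:
  fixes s :: "'a \<Rightarrow> 'b::comm_monoid_mult"
  assumes "(g ^^ T) a = a"
  shows "(\<Prod>i<T. s ((g ^^ i) ((g ^^ j) a))) = (\<Prod>i<T. s ((g ^^ i) a))"
proof (induction j)
  case (Suc j)
  then show ?case
    using prod_orbit_shift[where s = s, OF periodic_iterate[OF assms, of j]] by simp
qed simp

lemma cycle_multiplier_tent:
  assumes H: "H \<ge> 2" and c: "is_cycle (tent H) T \<eta>" and a: "a \<in> \<eta> ` {1..T}"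
  shows "cycle_multiplier (tent H) T \<eta> = (\<Prod>i<T. tent_slope H ((tent H ^^ i) a))"
proof -
  have T: "T \<ge> 1" using c by (simp add: is_cycle_def)
  have "cycle_multiplier (tent H) T \<eta> = (\<Prod>j=1..T. tent_slope H (\<eta> j))"
    unfolding cycle_multiplier_def
  proof (intro prod.cong refl deriv_tent)
    fix j assume "j \<in> {1..T}"
    then show "\<eta> j \<noteq> 1/2"
      using tent_periodic_ne_half[OF H T cycle_point_periodic[OF c]] by blast
  qed
  also have "\<dots> = (\<Prod>i<T. tent_slope H (\<eta> (Suc i)))"
    by (rule prod.reindex_bij_witness[of _ Suc "\<lambda>j. j - 1"]) auto
  also have "\<dots> = (\<Prod>i<T. tent_slope H ((tent H ^^ i) (\<eta> 1)))"
    by (intro prod.cong refl arg_cong[where f = "tent_slope H"] cycle_orbit[OF c]) simp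
  also have "\<dots> = (\<Prod>i<T. tent_slope H ((tent H ^^ i) a))"
  proof -
    obtain j where j: "a = (tent H ^^ j) (\<eta> 1)" using cycle_point_orbit[OF c a] .
    show ?thesis
      unfolding j by (simp only: prod_orbit_iterate[where s = "tent_slope H", OF cycle_first_periodic[OF c]])
  qed
  finally show ?thesis .
qed

lemma abs_prod_tent_slope:
  assumes "H \<ge> 0"
  shows "\<bar>\<Prod>i<T. tent_slope H (z i)\<bar> = H ^ T"
proof -
  have "\<bar>tent_slope H x\<bar> = H" for x using assms by (simp add: tent_slope_def)
  then show ?thesis by (simp add: abs_prod)
qed

text \<open>The control replaces the multiplier \<open>\<mu>\<close> of one full turn by the averaged slope
  \<open>\<theta> + (1 - \<theta>) \<mu>\<close>, which is then followed by a single step of slope \<open>\<plusminus>H\<close>.\<close>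
lemma controlled_tent_lipschitz_near_periodic_point:
  assumes H: "H \<ge> 2" and T: "T \<ge> 1" and per: "(tent H ^^ T) a = a"
    and mu: "(\<Prod>i<T. tent_slope H ((tent H ^^ i) a)) = \<mu>"
  shows "\<forall>\<^sub>F x in nhds a. dist (controlled_tent H T \<theta> x) (controlled_tent H T \<theta> a) \<le>
    (H * \<bar>\<theta> + (1 - \<theta>) * \<mu>\<bar>) * dist x a"
proof -
  let ?m = "\<theta> + (1 - \<theta>) * \<mu>"
  have "(tent H ^^ i) a \<noteq> 1/2" for i
    using tent_periodic_ne_half[OF H T periodic_iterate[OF per]] .
  then have "\<forall>\<^sub>F x in nhds a. (tent H ^^ T) x = a + \<mu> * (x - a)"
    using tent_iterate_affine_near[of T H a] by (simp add: per mu)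
  moreover have "\<forall>\<^sub>F x in nhds a. tent H (a + ?m * (x - a)) =
      tent H a + tent_slope H a * (a + ?m * (x - a) - a)"
    by (intro eventually_nhds_affine[where P = "\<lambda>y. tent H y = tent H a + tent_slope H a * (y - a)"]
          tent_affine_near tent_periodic_ne_half[OF H T per])
  ultimately show ?thesis
  proof eventually_elim
    case (elim x)
    have "\<theta> * x + (1 - \<theta>) * (tent H ^^ T) x = a + ?m * (x - a)"
      unfolding elim(1) by (simp add: algebra_simps)
    then have "controlled_tent H T \<theta> x = tent H a + tent_slope H a * (?m * (x - a))"
      unfolding controlled_tent_def using elim(2) by simp
    moreover have "controlled_tent H T \<theta> a = tent H a"
      unfolding controlled_tent_def per by (simp add: algebra_simps)
    moreover have "\<bar>tent_slope H a\<bar> = H" using H by (simp add: tent_slope_def)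
    ultimately show ?case by (simp add: dist_real_def abs_mult)
  qed
qed

section \<open>The controlled tent map\<close>

theorem theorem2:
  fixes H \<theta> :: real and T :: nat
  assumes "H \<ge> 2"
    and "T \<ge> 1"
    and "(H ^ T - 1 / H) / (H ^ T + 1) < \<theta>"
    and "\<theta> \<le> H ^ T / (H ^ T + 1)"
  shows "invariant_set {0..H / 2} (controlled_tent H T \<theta>) \<and>
    (\<forall>\<eta>. is_cycle (tent H) T \<eta> \<and> cycle_multiplier (tent H) T \<eta> < 0 \<longrightarrow>
         locally_asymptotically_stable_cycle (controlled_tent H T \<theta>) T \<eta>)"
proof (intro conjI allI impI)
  show "invariant_set {0..H / 2} (controlled_tent H T \<theta>)"
    by (rule controlled_tent_invariant[OF assms])
next
  fix \<eta> assume "is_cycle (tent H) T \<eta> \<and> cycle_multiplier (tent H) T \<eta> < 0"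
  then have c: "is_cycle (tent H) T \<eta>" and neg: "cycle_multiplier (tent H) T \<eta> < 0" by auto
  let ?F = "controlled_tent H T \<theta>" and ?C = "\<eta> ` {1..T}"
  define q where "q = H * \<bar>\<theta> + (1 - \<theta>) * - (H ^ T)\<bar>"
  have F_eq: "?F a = tent H a" if "a \<in> ?C" for a
    unfolding controlled_tent_def cycle_point_periodic[OF c that] by (simp add: algebra_simps)
  have cycF: "is_cycle ?F T \<eta>" using c is_cycle_cong[of \<eta> T ?F, OF F_eq] by simp
  have contr: "\<forall>\<^sub>F x in nhds a. dist (?F x) (?F a) \<le> q * dist x a" if a: "a \<in> ?C" for a
  proof -
    have "(\<Prod>i<T. tent_slope H ((tent H ^^ i) a)) = - (H ^ T)"
      using abs_prod_tent_slope[of H "\<lambda>i. (tent H ^^ i) a" T]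
        cycle_multiplier_tent[OF assms(1) c a] neg assms(1) by linarith
    then show ?thesis unfolding q_def
      by (intro controlled_tent_lipschitz_near_periodic_point assms cycle_point_periodic[OF c a])
  qed
  have p0: "H ^ T > 0" using assms by simp
  have "\<theta> + (1 - \<theta>) * - (H ^ T) \<le> 0" using assms(4) p0 by (simp add: field_simps)
  moreover have "- 1 < H * (\<theta> + (1 - \<theta>) * - (H ^ T))"
  proof -
    have "H ^ T - 1 / H < \<theta> * (H ^ T + 1)" using assms(3) p0 by (simp add: pos_divide_less_eq)
    then have "H * (H ^ T - 1 / H) < H * (\<theta> * (H ^ T + 1))"
      using assms(1) by (intro mult_strict_left_mono) auto
    then show ?thesis using assms(1) by (simp add: algebra_simps)
  qed
  ultimately have q: "0 \<le> q" "q < 1"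
    using assms(1) unfolding q_def by (simp_all add: abs_of_nonpos right_diff_distrib)
  have "finite ?C" "?C \<noteq> {}" using assms(2) by auto
  note stable = local_contraction_stable[OF this cycle_image_closed[OF cycF] q contr]
  show "locally_asymptotically_stable_cycle ?F T \<eta>"
    unfolding locally_asymptotically_stable_cycle_def using cycF stable by blast
qed

end
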